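(* Let $P$ be a PO system and $\mathscr{X}$ a complete semi-trim $P$-partition of the $\omega$-Stone space $W$. (a) $\mathscr{X}$ is a strongly semi-trim partition iff $\widehat{P}$ is weakly separated in $P$; (b) $\mathscr{X}$ is a rank partition of $W$ iff every element of $\widehat{P}$ is compact in $P$.
   Context: A PO system is a set $P$ with an antisymmetric transitive relation $<$ (possibly $p<p$ for some $p$); $p\leqslant q$ means $p<q$ or $p=q$; $p\lneqq q$ means $p\leqslant q$ and $p\neq q$; $P^{d}=\{p\in P: p\nless p\}$; $p_{\uparrow}=\{q\in P: q\geqslant p\}$. Suprema are with respect to $\leqslant$, and strictly increasing means strictly increasing with respect to $\lneqq$. An ideal of $P$ is a non-empty lower subset $J$ (closed downward under $\leqslant$) such that any $x,y\in J$ have a common upper bound $z\in J$. An element $p\in P$ is separated (in $P$) if it is not the supremum of a strictly increasing sequence in $P$; $p$ is compact in $P$ if for every ideal $J$ of $P$ with $p\leqslant\sup_P J$ (the supremum existing), we have $p\in J$. For PO systems $N\subseteq Q$ (with the induced relation on $N$), $N$ is weakly separated in $Q$ if whenever $p=\sup_Q J$ for some $p\in N$ and ideal $J$ of $N$, then $p\in J$. An $\omega$-Stone space $W$ is a locally compact Hausdorff space with a base of compact open sets, having only countably many compact open subsets (the Stone space of a countable Boolean ring, possibly without $1$). A complete $P$-partition $\mathscr{X}=\{X_p\mid p\in P\}$ of $W$ is a partition of $W$ into non-empty sets $X_p$ with $X_p'=\bigcup_{q<p}X_q$ for all $p\in P$, where $S'$ is the set of limit points of $S$. The label function $\tau\colon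 W\to P$ is given by $\tau(w)=p$ for $w\in X_p$. A compact open $A$ is $p$-trim if $\{q: A\cap X_q\neq\emptyset\}=p_{\uparrow}$ and, if $p\in P^d$, also $|A\cap X_p|=1$; a set is trim if it is $p$-trim for some $p$; $\widehat{P}$ is the set of $p$ for which there is a $p$-trim set. A point $w$ is clean if $w\in X_p$ for some $p$ and $w$ has a $p$-trim neighbourhood. $\mathscr{X}$ is semi-trim if: (T1) every element of $W$ has a neighbourhood base of trim sets; (T2) for each $p\in\widehat P$, every element of $W$ with a neighbourhood base of $p$-trim sets lies in $X_p$; (ST3) clean points are dense in $X_p$ for $p\in\widehat P$. It is strongly semi-trim if it satisfies T1, T2 and (SST3) all points in $X_p$ are clean for $p\in\widehat P$. A complete $P$-partition $\mathscr{X}$ is a rank $P$-partition if: (RP1) if $q$ is separated, $x=\lim x_k$, $\tau(x)\geqslant q$ and $\{\tau(x_k)\mid k\geqslant1\}$ are either pairwise strictly incomparable or strictly increasing, then $\tau(x_k)\geqslant q$ for almost all $k$ (all but finitely many); (RP2) if $\tau(x)$ is not separated, then we can write $x=\lim x_k$ with $\tau(x_k)\lneqq\tau(x)$ for all $k$. *)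

theory Defs
  imports "HOL-Analysis.Analysis"
begin

section \<open>PO systems\<close>

text \<open>A PO system is a carrier \<open>P\<close> with a relation \<open>lt\<close> that need not be irreflexive, so
  \<open>lt\<close> is not the strict part of the associated partial order \<open>po_le lt\<close>; that strict part
  is \<open>po_less lt\<close>.\<close>

definition po_system :: "'p set \<Rightarrow> ('p \<Rightarrow> 'p \<Rightarrow> bool) \<Rightarrow> bool" where
  "po_system P lt \<longleftrightarrow> antisymp_on P lt \<and> transp_on P lt"

definition po_le :: "('p \<Rightarrow> 'p \<Rightarrow> bool) \<Rightarrow> 'p \<Rightarrow> 'p \<Rightarrow> bool" where
  "po_le lt p q \<longleftrightarrow> lt p q \<or> p = q"

definition po_less :: "('p \<Rightarrow> 'p \<Rightarrow> bool) \<Rightarrow> 'p \<Rightarrow> 'p \<Rightarrow> bool" where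
  "po_less lt p q \<longleftrightarrow> po_le lt p q \<and> p \<noteq> q"

definition discrete_part :: "'p set \<Rightarrow> ('p \<Rightarrow> 'p \<Rightarrow> bool) \<Rightarrow> 'p set" where
  "discrete_part P lt = {p \<in> P. \<not> lt p p}"

definition up_set :: "'p set \<Rightarrow> ('p \<Rightarrow> 'p \<Rightarrow> bool) \<Rightarrow> 'p \<Rightarrow> 'p set" where
  "up_set P lt p = {q \<in> P. po_le lt p q}"

definition is_sup :: "'p set \<Rightarrow> ('p \<Rightarrow> 'p \<Rightarrow> bool) \<Rightarrow> 'p set \<Rightarrow> 'p \<Rightarrow> bool" where
  "is_sup P lt S s \<longleftrightarrow> s \<in> P \<and> (\<forall>x\<in>S. po_le lt x s) \<and>
     (\<forall>u\<in>P. (\<forall>x\<in>S. po_le lt x u) \<longrightarrow> po_le lt s u)"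

definition po_ideal :: "'p set \<Rightarrow> ('p \<Rightarrow> 'p \<Rightarrow> bool) \<Rightarrow> 'p set \<Rightarrow> bool" where
  "po_ideal P lt J \<longleftrightarrow> J \<subseteq> P \<and> J \<noteq> {} \<and>
     (\<forall>x\<in>J. \<forall>y\<in>P. po_le lt y x \<longrightarrow> y \<in> J) \<and>
     (\<forall>x\<in>J. \<forall>y\<in>J. \<exists>z\<in>J. po_le lt x z \<and> po_le lt y z)"

definition strictly_increasing :: "('p \<Rightarrow> 'p \<Rightarrow> bool) \<Rightarrow> (nat \<Rightarrow> 'p) \<Rightarrow> bool" where
  "strictly_increasing lt s \<longleftrightarrow> (\<forall>m n. m < n \<longrightarrow> po_less lt (s m) (s n))"

definition separated_elem :: "'p set \<Rightarrow> ('p \<Rightarrow> 'p \<Rightarrow> bool) \<Rightarrow> 'p \<Rightarrow> bool" where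
  "separated_elem P lt p \<longleftrightarrow> p \<in> P \<and>
     \<not> (\<exists>s. range s \<subseteq> P \<and> strictly_increasing lt s \<and> is_sup P lt (range s) p)"

definition compact_elem :: "'p set \<Rightarrow> ('p \<Rightarrow> 'p \<Rightarrow> bool) \<Rightarrow> 'p \<Rightarrow> bool" where
  "compact_elem P lt p \<longleftrightarrow> p \<in> P \<and>
     (\<forall>J s. po_ideal P lt J \<and> is_sup P lt J s \<and> po_le lt p s \<longrightarrow> p \<in> J)"

text \<open>\<open>J\<close> is an ideal of \<open>N\<close>, but its supremum is taken in \<open>Q\<close>.\<close>

definition weakly_separated :: "'p set \<Rightarrow> 'p set \<Rightarrow> ('p \<Rightarrow> 'p \<Rightarrow> bool) \<Rightarrow> bool" where
  "weakly_separated N Q lt \<longleftrightarrow> N \<subseteq> Q \<and>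
     (\<forall>p\<in>N. \<forall>J. po_ideal N lt J \<and> is_sup Q lt J p \<longrightarrow> p \<in> J)"

section \<open>Partitions of Stone spaces\<close>

definition compact_open :: "'w topology \<Rightarrow> 'w set \<Rightarrow> bool" where
  "compact_open W A \<longleftrightarrow> compactin W A \<and> openin W A"

definition omega_stone_space :: "'w topology \<Rightarrow> bool" where
  "omega_stone_space W \<longleftrightarrow> Hausdorff_space W \<and> locally_compact_space W \<and>
     openin W = arbitrary union_of compact_open W \<and> countable {A. compact_open W A}"

definition complete_partition ::
    "'p set \<Rightarrow> ('p \<Rightarrow> 'p \<Rightarrow> bool) \<Rightarrow> 'w topology \<Rightarrow> ('p \<Rightarrow> 'w set) \<Rightarrow> bool" where
  "complete_partition P lt W X \<longleftrightarrow>
     (\<Union>p\<in>P. X p) = topspace W \<and> (\<forall>p\<in>P. X p \<noteq> {}) \<and>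
     (\<forall>p\<in>P. \<forall>q\<in>P. p \<noteq> q \<longrightarrow> X p \<inter> X q = {}) \<and>
     (\<forall>p\<in>P. W derived_set_of X p = (\<Union>q\<in>{q\<in>P. lt q p}. X q))"

definition label :: "'p set \<Rightarrow> ('p \<Rightarrow> 'w set) \<Rightarrow> 'w \<Rightarrow> 'p" where
  "label P X w = (THE p. p \<in> P \<and> w \<in> X p)"

definition p_trim ::
    "'p set \<Rightarrow> ('p \<Rightarrow> 'p \<Rightarrow> bool) \<Rightarrow> 'w topology \<Rightarrow> ('p \<Rightarrow> 'w set) \<Rightarrow> 'p \<Rightarrow> 'w set \<Rightarrow> bool" where
  "p_trim P lt W X p A \<longleftrightarrow> p \<in> P \<and> compact_open W A \<and>
     {q \<in> P. A \<inter> X q \<noteq> {}} = up_set P lt p \<and>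
     (p \<in> discrete_part P lt \<longrightarrow> card (A \<inter> X p) = 1)"

definition trim ::
    "'p set \<Rightarrow> ('p \<Rightarrow> 'p \<Rightarrow> bool) \<Rightarrow> 'w topology \<Rightarrow> ('p \<Rightarrow> 'w set) \<Rightarrow> 'w set \<Rightarrow> bool" where
  "trim P lt W X A \<longleftrightarrow> (\<exists>p\<in>P. p_trim P lt W X p A)"

definition trim_labels ::
    "'p set \<Rightarrow> ('p \<Rightarrow> 'p \<Rightarrow> bool) \<Rightarrow> 'w topology \<Rightarrow> ('p \<Rightarrow> 'w set) \<Rightarrow> 'p set" where
  "trim_labels P lt W X = {p \<in> P. \<exists>A. p_trim P lt W X p A}"

text \<open>Trim sets are open, so a trim set is a neighbourhood of each of its points.\<close>

definition clean ::
    "'p set \<Rightarrow> ('p \<Rightarrow> 'p \<Rightarrow> bool) \<Rightarrow> 'w topology \<Rightarrow> ('p \<Rightarrow> 'w set) \<Rightarrow> 'w \<Rightarrow> bool" where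
  "clean P lt W X w \<longleftrightarrow> (\<exists>p\<in>P. w \<in> X p \<and> (\<exists>A. p_trim P lt W X p A \<and> w \<in> A))"

definition T1 ::
    "'p set \<Rightarrow> ('p \<Rightarrow> 'p \<Rightarrow> bool) \<Rightarrow> 'w topology \<Rightarrow> ('p \<Rightarrow> 'w set) \<Rightarrow> bool" where
  "T1 P lt W X \<longleftrightarrow>
     (\<forall>w\<in>topspace W. neighbourhood_base_at w (trim P lt W X) W)"

definition T2 ::
    "'p set \<Rightarrow> ('p \<Rightarrow> 'p \<Rightarrow> bool) \<Rightarrow> 'w topology \<Rightarrow> ('p \<Rightarrow> 'w set) \<Rightarrow> bool" where
  "T2 P lt W X \<longleftrightarrow>
     (\<forall>p\<in>trim_labels P lt W X. \<forall>w\<in>topspace W.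
        neighbourhood_base_at w (p_trim P lt W X p) W \<longrightarrow> w \<in> X p)"

definition ST3 ::
    "'p set \<Rightarrow> ('p \<Rightarrow> 'p \<Rightarrow> bool) \<Rightarrow> 'w topology \<Rightarrow> ('p \<Rightarrow> 'w set) \<Rightarrow> bool" where
  "ST3 P lt W X \<longleftrightarrow>
     (\<forall>p\<in>trim_labels P lt W X. X p \<subseteq> W closure_of {w \<in> X p. clean P lt W X w})"

definition SST3 ::
    "'p set \<Rightarrow> ('p \<Rightarrow> 'p \<Rightarrow> bool) \<Rightarrow> 'w topology \<Rightarrow> ('p \<Rightarrow> 'w set) \<Rightarrow> bool" where
  "SST3 P lt W X \<longleftrightarrow> (\<forall>p\<in>trim_labels P lt W X. \<forall>w\<in>X p. clean P lt W X w)"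

definition semi_trim_partition ::
    "'p set \<Rightarrow> ('p \<Rightarrow> 'p \<Rightarrow> bool) \<Rightarrow> 'w topology \<Rightarrow> ('p \<Rightarrow> 'w set) \<Rightarrow> bool" where
  "semi_trim_partition P lt W X \<longleftrightarrow>
     complete_partition P lt W X \<and> T1 P lt W X \<and> T2 P lt W X \<and> ST3 P lt W X"

definition strongly_semi_trim_partition ::
    "'p set \<Rightarrow> ('p \<Rightarrow> 'p \<Rightarrow> bool) \<Rightarrow> 'w topology \<Rightarrow> ('p \<Rightarrow> 'w set) \<Rightarrow> bool" where
  "strongly_semi_trim_partition P lt W X \<longleftrightarrow>
     complete_partition P lt W X \<and> T1 P lt W X \<and> T2 P lt W X \<and> SST3 P lt W X"

definition pairwise_incomparable :: "('p \<Rightarrow> 'p \<Rightarrow> bool) \<Rightarrow> (nat \<Rightarrow> 'p) \<Rightarrow> bool" where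
  "pairwise_incomparable lt s \<longleftrightarrow> (\<forall>m n. m \<noteq> n \<longrightarrow> \<not> po_le lt (s m) (s n))"

definition RP1 ::
    "'p set \<Rightarrow> ('p \<Rightarrow> 'p \<Rightarrow> bool) \<Rightarrow> 'w topology \<Rightarrow> ('p \<Rightarrow> 'w set) \<Rightarrow> bool" where
  "RP1 P lt W X \<longleftrightarrow>
     (\<forall>q x xs. separated_elem P lt q \<and> x \<in> topspace W \<and> range xs \<subseteq> topspace W \<and>
        limitin W xs x sequentially \<and> po_le lt q (label P X x) \<and>
        (pairwise_incomparable lt (\<lambda>k. label P X (xs k)) \<or>
         strictly_increasing lt (\<lambda>k. label P X (xs k)))
        \<longrightarrow> (\<forall>\<^sub>F k in sequentially. po_le lt q (label P X (xs k))))"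

definition RP2 ::
    "'p set \<Rightarrow> ('p \<Rightarrow> 'p \<Rightarrow> bool) \<Rightarrow> 'w topology \<Rightarrow> ('p \<Rightarrow> 'w set) \<Rightarrow> bool" where
  "RP2 P lt W X \<longleftrightarrow>
     (\<forall>x\<in>topspace W. \<not> separated_elem P lt (label P X x) \<longrightarrow>
        (\<exists>xs. range xs \<subseteq> topspace W \<and> limitin W xs x sequentially \<and>
           (\<forall>k. po_less lt (label P X (xs k)) (label P X x))))"

definition rank_partition ::
    "'p set \<Rightarrow> ('p \<Rightarrow> 'p \<Rightarrow> bool) \<Rightarrow> 'w topology \<Rightarrow> ('p \<Rightarrow> 'w set) \<Rightarrow> bool" where
  "rank_partition P lt W X \<longleftrightarrow> complete_partition P lt W X \<and> RP1 P lt W X \<and> RP2 P lt W X"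

end

theory Submission
  imports Defs
begin

text \<open>Everything rests on attaching to each point \<open>w\<close> the set \<open>trim_ideal w\<close> of those
  \<open>p\<close> for which \<open>w\<close> has a \<open>p\<close>-trim neighbourhood. By T1 and completeness this is an ideal of
  \<open>Phat\<close> (the set of labels of trim sets) whose supremum in the whole of \<open>P\<close> is the
  label of \<open>w\<close> (\<open>trim_ideal_is_ideal\<close>, \<open>trim_ideal_sup\<close>), and \<open>w\<close> is clean exactly when its label
  belongs to it. Conversely, density of clean points allows trim sets to be nested so as to shrink to
  a single point, so every ideal of \<open>Phat\<close> is \<open>trim_ideal w\<close> for some \<open>w\<close>
  (\<open>trim_ideal_realises_ideal\<close>).

  For the first equivalence, strong semi-trimness says that an ideal of the form \<open>trim_ideal w\<close>
  contains its supremum as soon as that supremum lies in \<open>Phat\<close>. As these are all the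
  ideals of \<open>Phat\<close>, this is weak separation.

  For the second, both sides amount to the same uniformity property: \<open>trim_ideal w\<close> consists of
  all \<open>p \<in> Phat\<close> below the label of \<open>w\<close>, rather than being just some ideal with the right supremum.
  Compactness of the elements of \<open>Phat\<close> yields it at once, and then RP1 is
  immediate from trim neighbourhoods, because separated elements all lie in \<open>Phat\<close>; RP2 holds
  because compact elements are separated, so that a label which is not separated lies outside
  \<open>Phat\<close> and differs from the types of all trim neighbourhoods of its points.
  In the other direction, RP2 makes the elements of \<open>Phat\<close> separated, and RP1 applied to points of
  shrinking trim neighbourhoods with strictly increasing labels gives uniformity. An ideal of \<open>P\<close>
  then traces an ideal on \<open>Phat\<close> with the same supremum; a point realising that trace
  shows that every \<open>q \<in> Phat\<close> below the supremum is in the ideal.\<close>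

section \<open>Ideals in PO systems\<close>

locale po_sys =
  fixes P :: "'p set" and lt :: "'p \<Rightarrow> 'p \<Rightarrow> bool"
  assumes po_system: "po_system P lt"
begin

abbreviation le (infix "\<preceq>" 50) where "p \<preceq> q \<equiv> po_le lt p q"

lemma le_refl [simp]: "p \<preceq> p"
  by (simp add: po_le_def)

lemma le_trans: "p \<preceq> q \<Longrightarrow> q \<preceq> r \<Longrightarrow> p \<in> P \<Longrightarrow> q \<in> P \<Longrightarrow> r \<in> P \<Longrightarrow> p \<preceq> r"
  using po_system unfolding po_system_def po_le_def by (metis transp_onD)

lemma le_antisym: "p \<preceq> q \<Longrightarrow> q \<preceq> p \<Longrightarrow> p \<in> P \<Longrightarrow> q \<in> P \<Longrightarrow> p = q"
  using po_system unfolding po_system_def po_le_def by (metis antisymp_onD)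

lemma sup_unique: "is_sup P lt S s \<Longrightarrow> is_sup P lt S t \<Longrightarrow> s = t"
  unfolding is_sup_def by (blast intro: le_antisym)

lemma ideal_directed:
  assumes "po_ideal N lt J" "x \<in> J" "y \<in> J"
  obtains z where "z \<in> J" "x \<preceq> z" "y \<preceq> z"
  using assms unfolding po_ideal_def by blast

text \<open>In an ideal without a greatest element every element lies strictly below another one, so
  directedness lets a strictly increasing sequence overtake the given one term by term. Taking
  \<open>e\<close> to enumerate a countable ideal makes the new sequence cofinal; taking \<open>e\<close> to be
  the types of shrinking neighbourhoods makes it the labels of a convergent sequence.\<close>

lemma ideal_dominating_sequence:
  assumes J: "po_ideal N lt J" and "N \<subseteq> P"
    and no_greatest: "\<not> (\<exists>m\<in>J. \<forall>x\<in>J. x \<preceq> m)"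
    and e: "range e \<subseteq> J"
  obtains s where "range s \<subseteq> J" "strictly_increasing lt s" "\<And>n. e n \<preceq> s n"
proof -
  have JP: "J \<subseteq> P" using J \<open>N \<subseteq> P\<close> unfolding po_ideal_def by blast
  have step: "\<exists>z\<in>J. po_less lt x z \<and> y \<preceq> z" if xy: "x \<in> J" "y \<in> J" for x y
  proof -
    obtain u where u: "u \<in> J" "x \<preceq> u" "y \<preceq> u"
      using ideal_directed[OF J xy] .
    obtain v where v: "v \<in> J" "\<not> v \<preceq> u" using no_greatest u(1) by blast
    obtain z where z: "z \<in> J" "u \<preceq> z" "v \<preceq> z"
      using ideal_directed[OF J u(1) v(1)] .
    have P: "x \<in> P" "y \<in> P" "u \<in> P" "v \<in> P" "z \<in> P" using JP xy u v z by auto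
    have "x \<preceq> z" "y \<preceq> z" using le_trans u z P by blast+
    moreover have "x \<noteq> z" using le_antisym u z v P by metis
    ultimately show ?thesis using z unfolding po_less_def by blast
  qed
  have "\<exists>s. \<forall>n. (s n \<in> J \<and> e n \<preceq> s n) \<and> po_less lt (s n) (s (Suc n))"
  proof (rule dependent_nat_choice)
    show "\<exists>x. x \<in> J \<and> e 0 \<preceq> x" using e by (intro exI[of _ "e 0"]) auto
    show "\<exists>y. (y \<in> J \<and> e (Suc n) \<preceq> y) \<and> po_less lt x y" if "x \<in> J \<and> e n \<preceq> x" for x n
      using step[of x "e (Suc n)"] e that by blast
  qed
  then obtain s where s: "\<And>n. s n \<in> J" "\<And>n. e n \<preceq> s n" "\<And>n. po_less lt (s n) (s (Suc n))"
    by blast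
  have "po_less lt (s m) (s n)" if "m < n" for m n
    using that
  proof (induction rule: less_Suc_induct)
    case (1 i) then show ?case using s by blast
  next
    case (2 i j k)
    have P: "s i \<in> P" "s j \<in> P" "s k \<in> P" using s(1) JP by auto
    show ?case using 2 P le_trans[of "s i" "s j" "s k"] le_antisym[of "s i" "s j"]
      unfolding po_less_def by metis
  qed
  then show ?thesis using that s unfolding strictly_increasing_def by blast
qed

lemma ideal_cofinal_chain:
  assumes J: "po_ideal N lt J" and "N \<subseteq> P" and "countable J"
  obtains s where "range s \<subseteq> J" "\<And>n. s n \<preceq> s (Suc n)" "\<And>x. x \<in> J \<Longrightarrow> \<exists>n. x \<preceq> s n"
proof (cases "\<exists>m\<in>J. \<forall>x\<in>J. x \<preceq> m")
  case True
  then obtain m where "m \<in> J" "\<forall>x\<in>J. x \<preceq> m" by blast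
  then show ?thesis using that[of "\<lambda>n. m"] by auto
next
  case False
  have "J \<noteq> {}" using J unfolding po_ideal_def by blast
  then have e: "range (from_nat_into J) = J" using \<open>countable J\<close> by (rule range_from_nat_into)
  obtain s where s: "range s \<subseteq> J" "strictly_increasing lt s" "\<And>n. from_nat_into J n \<preceq> s n"
    using ideal_dominating_sequence[OF J \<open>N \<subseteq> P\<close> False, of "from_nat_into J"] e by blast
  show ?thesis
  proof (rule that)
    show "range s \<subseteq> J" by fact
    show "s n \<preceq> s (Suc n)" for n
      using s(2) unfolding strictly_increasing_def po_less_def by blast
    show "\<exists>n. x \<preceq> s n" if "x \<in> J" for x
      using s(3) e that by (metis imageE)
  qed
qed

text \<open>A countable ideal without a greatest element has a strictly increasing cofinal sequence, whose
  supremum is that of the ideal. A separated supremum therefore has to be a greatest element.\<close>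

lemma separated_sup_in_ideal:
  assumes q: "separated_elem P lt q" and J: "po_ideal N lt J" and "N \<subseteq> P" and "countable J"
    and sup: "is_sup P lt J q"
  shows "q \<in> J"
proof (cases "\<exists>m\<in>J. \<forall>x\<in>J. x \<preceq> m")
  case True
  then obtain m where m: "m \<in> J" "\<forall>x\<in>J. x \<preceq> m" by blast
  moreover have "m \<in> P" using m J \<open>N \<subseteq> P\<close> unfolding po_ideal_def by blast
  ultimately have "is_sup P lt J m" unfolding is_sup_def by blast
  then show ?thesis using sup_unique sup m by blast
next
  case False
  have JP: "J \<subseteq> P" using J \<open>N \<subseteq> P\<close> unfolding po_ideal_def by blast
  have "J \<noteq> {}" using J unfolding po_ideal_def by blast
  then have e: "range (from_nat_into J) = J" using \<open>countable J\<close> by (rule range_from_nat_into)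
  obtain s where s: "range s \<subseteq> J" "strictly_increasing lt s" "\<And>n. from_nat_into J n \<preceq> s n"
    using ideal_dominating_sequence[OF J \<open>N \<subseteq> P\<close> False, of "from_nat_into J"] e by blast
  have "q \<preceq> u" if "u \<in> P" "\<forall>x\<in>range s. x \<preceq> u" for u
  proof -
    have "x \<preceq> u" if "x \<in> J" for x
    proof -
      obtain n where n: "x = from_nat_into J n" using e \<open>x \<in> J\<close> by (metis imageE)
      have "x \<preceq> s n" using n s(3) by simp
      moreover have "s n \<preceq> u" "s n \<in> P" "x \<in> P"
        using \<open>\<forall>x\<in>range s. x \<preceq> u\<close> s(1) JP \<open>x \<in> J\<close> by auto
      ultimately show ?thesis using le_trans \<open>u \<in> P\<close> by blast
    qed
    then show ?thesis using sup \<open>u \<in> P\<close> unfolding is_sup_def by blast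
  qed
  then have "is_sup P lt (range s) q" using sup s(1) unfolding is_sup_def by blast
  then show ?thesis using q s JP unfolding separated_elem_def by blast
qed

text \<open>Compactness is defined through ideals, but a directed set has the same supremum as the ideal
  of \<open>P\<close> that it generates. This makes compactness applicable to ideals of subsets of \<open>P\<close> and to
  increasing sequences.\<close>

lemma compact_below_directed_sup:
  assumes c: "compact_elem P lt p" and D: "D \<subseteq> P" "D \<noteq> {}"
    and dir: "\<And>x y. x \<in> D \<Longrightarrow> y \<in> D \<Longrightarrow> \<exists>z\<in>D. x \<preceq> z \<and> y \<preceq> z"
    and sup: "is_sup P lt D s" and "p \<preceq> s"
  shows "\<exists>d\<in>D. p \<preceq> d"
proof -
  define J where "J = {x \<in> P. \<exists>d\<in>D. x \<preceq> d}"
  have DJ: "D \<subseteq> J" using D(1) le_refl unfolding J_def by blast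
  have "po_ideal P lt J"
    unfolding po_ideal_def
  proof (intro conjI ballI impI)
    show "J \<subseteq> P" unfolding J_def by blast
    show "J \<noteq> {}" using DJ D by blast
    show "y \<in> J" if "x \<in> J" "y \<in> P" "y \<preceq> x" for x y
      using that D(1) le_trans[of y x] unfolding J_def by blast
    show "\<exists>z\<in>J. x \<preceq> z \<and> y \<preceq> z" if xy: "x \<in> J" "y \<in> J" for x y
    proof -
      obtain a b where ab: "a \<in> D" "b \<in> D" "x \<preceq> a" "y \<preceq> b" "x \<in> P" "y \<in> P"
        using xy unfolding J_def by blast
      obtain z where z: "z \<in> D" "a \<preceq> z" "b \<preceq> z" using dir ab by blast
      have "x \<preceq> z" "y \<preceq> z" using le_trans[of x a z] le_trans[of y b z] ab z D(1) by blast+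
      then show ?thesis using DJ z(1) by blast
    qed
  qed
  moreover have "is_sup P lt J s"
    unfolding is_sup_def
  proof (intro conjI ballI impI)
    show "s \<in> P" using sup unfolding is_sup_def by blast
    show "x \<preceq> s" if "x \<in> J" for x
    proof -
      obtain d where "x \<in> P" "d \<in> D" "x \<preceq> d" using \<open>x \<in> J\<close> unfolding J_def by blast
      then show ?thesis using sup D(1) le_trans[of x d s] unfolding is_sup_def by blast
    qed
    show "s \<preceq> u" if "u \<in> P" "\<forall>x\<in>J. x \<preceq> u" for u
      using sup that DJ unfolding is_sup_def by blast
  qed
  ultimately have "p \<in> J" using c \<open>p \<preceq> s\<close> unfolding compact_elem_def by blast
  then show ?thesis unfolding J_def by blast
qed

text \<open>If \<open>p\<close> were the supremum of a strictly increasing sequence, compactness would put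
  \<open>p\<close> below one of its terms, leaving no room for the next one.\<close>

lemma compact_imp_separated:
  assumes "compact_elem P lt p"
  shows "separated_elem P lt p"
proof (rule ccontr)
  assume "\<not> separated_elem P lt p"
  moreover have pP: "p \<in> P" using assms unfolding compact_elem_def by blast
  ultimately obtain s where s: "range s \<subseteq> P" "strictly_increasing lt s" "is_sup P lt (range s) p"
    unfolding separated_elem_def by blast
  have mono: "s m \<preceq> s n" if "m \<le> n" for m n
    using s(2) that unfolding strictly_increasing_def po_less_def by (metis le_neq_implies_less le_refl)
  have "\<exists>d\<in>range s. p \<preceq> d"
  proof (rule compact_below_directed_sup[OF assms s(1) _ _ s(3) le_refl])
    show "\<exists>z\<in>range s. x \<preceq> z \<and> y \<preceq> z" if xy: "x \<in> range s" "y \<in> range s" for x y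
    proof -
      obtain i j where "x = s i" "y = s j" using xy by blast
      then have "x \<preceq> s (max i j)" "y \<preceq> s (max i j)" using mono by auto
      then show ?thesis by blast
    qed
  qed simp
  then obtain n where "p \<preceq> s n" by blast
  have P: "s n \<in> P" "s (Suc n) \<in> P" using s(1) by auto
  have "s n \<preceq> s (Suc n)" "s n \<noteq> s (Suc n)"
    using s(2) unfolding strictly_increasing_def po_less_def by auto
  moreover have "s (Suc n) \<preceq> s n"
    using s(3) \<open>p \<preceq> s n\<close> P pP le_trans[of "s (Suc n)" p "s n"] unfolding is_sup_def by blast
  ultimately show False using le_antisym P by blast
qed

end

section \<open>The ideal of trim types around a point\<close>

text \<open>A fixed enumeration of the base allows neighbourhoods to be shrunk in countably many steps.\<close>

lemma compact_open_base_enumeration: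
  assumes "omega_stone_space W"
  obtains E :: "nat \<Rightarrow> 'w set" where "\<And>n. compact_open W (E n)"
    "\<And>U w. openin W U \<Longrightarrow> w \<in> U \<Longrightarrow> \<exists>n. w \<in> E n \<and> E n \<subseteq> U"
proof -
  let ?C = "{A. compact_open W A}"
  have "compact_open W {}" unfolding compact_open_def by simp
  then have "?C \<noteq> {}" by blast
  moreover have "countable ?C" using assms unfolding omega_stone_space_def by blast
  ultimately have E: "range (from_nat_into ?C) = ?C" by (rule range_from_nat_into)
  show ?thesis
  proof (rule that)
    show "compact_open W (from_nat_into ?C n)" for n using E by blast
    fix U w assume "openin W U" "w \<in> U"
    then have "(arbitrary union_of compact_open W) U"
      using assms unfolding omega_stone_space_def by simp
    then obtain A where A: "compact_open W A" "w \<in> A" "A \<subseteq> U"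
      using \<open>w \<in> U\<close> unfolding union_of_def by blast
    then have "A \<in> range (from_nat_into ?C)" using E by simp
    then show "\<exists>n. w \<in> from_nat_into ?C n \<and> from_nat_into ?C n \<subseteq> U"
      using A(2,3) by (elim rangeE) blast
  qed
qed

lemma limitin_shrinking_sets:
  assumes "w \<in> topspace W"
    and "\<And>U. openin W U \<Longrightarrow> w \<in> U \<Longrightarrow> \<exists>N. \<forall>n\<ge>N. D n \<subseteq> U"
    and "\<And>n. xs n \<in> D n"
  shows "limitin W xs w sequentially"
  unfolding limitin_def eventually_sequentially using assms by (meson subsetD)

locale T1_partition = po_sys P lt for P :: "'p set" and lt :: "'p \<Rightarrow> 'p \<Rightarrow> bool" +
  fixes W :: "'w topology" and X :: "'p \<Rightarrow> 'w set"
  assumes stone: "omega_stone_space W"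
    and complete: "complete_partition P lt W X"
    and T1: "T1 P lt W X"
begin

abbreviation Phat where "Phat \<equiv> trim_labels P lt W X"
abbreviation ptrim where "ptrim \<equiv> p_trim P lt W X"
abbreviation lab where "lab \<equiv> label P X"

definition trim_ideal :: "'w \<Rightarrow> 'p set" where
  "trim_ideal w = {p. \<exists>A. ptrim p A \<and> w \<in> A}"

lemma ptrim_open: "ptrim p A \<Longrightarrow> openin W A"
  unfolding p_trim_def compact_open_def by blast

lemma ptrim_in_Phat: "ptrim p A \<Longrightarrow> p \<in> Phat"
  unfolding p_trim_def trim_labels_def by blast

lemma Phat_subset: "Phat \<subseteq> P"
  unfolding trim_labels_def by blast

lemma ptrim_meets_iff: "ptrim p A \<Longrightarrow> q \<in> P \<Longrightarrow> A \<inter> X q \<noteq> {} \<longleftrightarrow> p \<preceq> q"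
  unfolding p_trim_def up_set_def by (auto simp: set_eq_iff)

lemma parts_cover: "(\<Union>p\<in>P. X p) = topspace W"
  using complete unfolding complete_partition_def by (elim conjE)

lemma parts_disjoint: "p \<in> P \<Longrightarrow> q \<in> P \<Longrightarrow> w \<in> X p \<Longrightarrow> w \<in> X q \<Longrightarrow> p = q"
  using complete unfolding complete_partition_def by (metis disjoint_iff)

lemma label_eq: "p \<in> P \<Longrightarrow> w \<in> X p \<Longrightarrow> lab w = p"
  unfolding label_def by (rule the_equality) (auto dest: parts_disjoint)

lemma label_in: assumes "w \<in> topspace W" shows "lab w \<in> P" "w \<in> X (lab w)"
proof -
  obtain p where "p \<in> P" "w \<in> X p" using parts_cover assms by blast
  then show "lab w \<in> P" "w \<in> X (lab w)" using label_eq by auto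
qed

lemma part_subset: "p \<in> P \<Longrightarrow> X p \<subseteq> topspace W"
  using parts_cover by blast

lemma part_nonempty: "p \<in> P \<Longrightarrow> \<exists>w. w \<in> X p"
  using complete unfolding complete_partition_def by auto

text \<open>Completeness describes the closure of \<open>X u\<close> as the union of the parts with labels below
  \<open>u\<close>.\<close>

lemma label_le_if_adherent:
  assumes "w \<in> topspace W" "u \<in> P" and "\<And>U. openin W U \<Longrightarrow> w \<in> U \<Longrightarrow> U \<inter> X u \<noteq> {}"
  shows "lab w \<preceq> u"
proof -
  have "w \<in> W closure_of X u"
    using assms unfolding in_closure_of by blast
  then have "w \<in> X u \<or> w \<in> W derived_set_of X u"
    unfolding closure_of by blast
  moreover have "W derived_set_of X u = (\<Union>q\<in>{q\<in>P. lt q u}. X q)"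
    using complete \<open>u \<in> P\<close> unfolding complete_partition_def by (elim conjE bspec)
  ultimately show ?thesis
    using label_eq \<open>u \<in> P\<close> unfolding po_le_def by blast
qed

lemma trim_neighbourhood:
  assumes "openin W U" "w \<in> U"
  obtains p A where "ptrim p A" "w \<in> A" "A \<subseteq> U"
proof -
  have "w \<in> topspace W" using assms openin_subset by blast
  then have "neighbourhood_base_at w (trim P lt W X) W" using T1 unfolding T1_def by blast
  then show ?thesis
    using assms that unfolding neighbourhood_base_at_def trim_def by blast
qed

lemma trim_ideal_subset: "trim_ideal w \<subseteq> Phat"
  unfolding trim_ideal_def using ptrim_in_Phat by blast

lemma trim_ideal_le_label: "p \<in> trim_ideal w \<Longrightarrow> p \<preceq> lab w"
proof -
  assume "p \<in> trim_ideal w"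
  then obtain A where A: "ptrim p A" "w \<in> A" unfolding trim_ideal_def by blast
  then have "w \<in> topspace W" using ptrim_open openin_subset by blast
  then show ?thesis using A ptrim_meets_iff label_in by blast
qed

lemma ptrim_subset_le:
  assumes "ptrim p A" "ptrim q B" "A \<subseteq> B" shows "q \<preceq> p"
proof -
  have "p \<in> P" using assms(1) unfolding p_trim_def by blast
  then have "A \<inter> X p \<noteq> {}" using ptrim_meets_iff[OF assms(1)] by simp
  then show ?thesis using ptrim_meets_iff[OF assms(2)] assms(3) \<open>p \<in> P\<close> by blast
qed

text \<open>Enlarging a \<open>q\<close>-trim set by a set of strictly larger type adds neither a label that was missing
  nor a point of \<open>X q\<close>, so that the cardinality condition also survives. Hence a point with a
  \<open>p\<close>-trim neighbourhood has a \<open>q\<close>-trim one for every smaller label \<open>q\<close> of a trim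
  set, wherever that trim set lies.\<close>

lemma ptrim_union:
  assumes A: "ptrim p A" and B: "ptrim q B" and "q \<preceq> p" "p \<noteq> q"
  shows "ptrim q (A \<union> B)"
proof -
  have P: "p \<in> P" "q \<in> P" using A B unfolding p_trim_def by blast+
  have "compact_open W (A \<union> B)"
    using A B unfolding p_trim_def compact_open_def by (simp add: compactin_Un openin_Un)
  moreover have "(A \<union> B) \<inter> X r \<noteq> {} \<longleftrightarrow> q \<preceq> r" if "r \<in> P" for r
    using ptrim_meets_iff[OF A that] ptrim_meets_iff[OF B that] le_trans[OF \<open>q \<preceq> p\<close>] P that
    by (auto simp: Int_Un_distrib2)
  moreover have "A \<inter> X q = {}"
    using ptrim_meets_iff[OF A] P le_antisym \<open>q \<preceq> p\<close> \<open>p \<noteq> q\<close> by blast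
  then have "(A \<union> B) \<inter> X q = B \<inter> X q" by blast
  ultimately show ?thesis using B unfolding p_trim_def up_set_def by auto
qed

lemma trim_ideal_is_ideal:
  assumes "w \<in> topspace W"
  shows "po_ideal Phat lt (trim_ideal w)"
  unfolding po_ideal_def
proof (intro conjI ballI impI)
  show "trim_ideal w \<subseteq> Phat" by (rule trim_ideal_subset)
  show "trim_ideal w \<noteq> {}"
    using trim_neighbourhood[OF openin_topspace assms] unfolding trim_ideal_def by blast
  show "q \<in> trim_ideal w" if pq: "p \<in> trim_ideal w" "q \<in> Phat" "q \<preceq> p" for p q
  proof (cases "p = q")
    case False
    obtain A B where "ptrim p A" "w \<in> A" "ptrim q B"
      using pq unfolding trim_ideal_def trim_labels_def by blast
    then show ?thesis
      using ptrim_union[OF _ _ \<open>q \<preceq> p\<close> False] unfolding trim_ideal_def by blast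
  qed (use pq in simp)
  show "\<exists>r\<in>trim_ideal w. p \<preceq> r \<and> q \<preceq> r" if pq: "p \<in> trim_ideal w" "q \<in> trim_ideal w" for p q
  proof -
    obtain A B where AB: "ptrim p A" "w \<in> A" "ptrim q B" "w \<in> B"
      using pq unfolding trim_ideal_def by blast
    then have "openin W (A \<inter> B)" "w \<in> A \<inter> B" using ptrim_open by auto
    then obtain r C where C: "ptrim r C" "w \<in> C" "C \<subseteq> A \<inter> B" by (rule trim_neighbourhood)
    then have "p \<preceq> r" "q \<preceq> r" using ptrim_subset_le AB by blast+
    then show ?thesis using C unfolding trim_ideal_def by blast
  qed
qed

text \<open>If \<open>u\<close> bounds \<open>trim_ideal w\<close>, every trim neighbourhood of \<open>w\<close> meets
  \<open>X u\<close>; these form a base, so \<open>w\<close> is adherent to \<open>X u\<close> and its label is at most \<open>u\<close>.\<close>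

lemma trim_ideal_sup:
  assumes w: "w \<in> topspace W"
  shows "is_sup P lt (trim_ideal w) (lab w)"
  unfolding is_sup_def
proof (intro conjI ballI impI)
  show "lab w \<in> P" using label_in w by blast
  show "p \<preceq> lab w" if "p \<in> trim_ideal w" for p using trim_ideal_le_label that .
  show "lab w \<preceq> u" if u: "u \<in> P" "\<forall>p\<in>trim_ideal w. p \<preceq> u" for u
  proof (rule label_le_if_adherent[OF w u(1)])
    fix U assume "openin W U" "w \<in> U"
    then obtain p A where A: "ptrim p A" "w \<in> A" "A \<subseteq> U" by (rule trim_neighbourhood)
    then have "p \<preceq> u" using u(2) unfolding trim_ideal_def by blast
    then show "U \<inter> X u \<noteq> {}" using ptrim_meets_iff A u(1) by blast
  qed
qed

text \<open>A trim set determines its type, and there are only countably many compact open sets.\<close>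

lemma countable_Phat: "countable Phat"
proof -
  have "\<exists>A. ptrim p A" if "p \<in> Phat" for p using that unfolding trim_labels_def by blast
  then obtain f where f: "\<And>p. p \<in> Phat \<Longrightarrow> ptrim p (f p)" by metis
  have "p = q" if "p \<in> Phat" "q \<in> Phat" "f p = f q" for p q
    using ptrim_subset_le[of p "f p" q "f q"] ptrim_subset_le[of q "f q" p "f p"] f that
      le_antisym Phat_subset by blast
  then have "inj_on f Phat" by (rule inj_onI)
  moreover have "f ` Phat \<subseteq> {A. compact_open W A}" using f unfolding p_trim_def by blast
  then have "countable (f ` Phat)"
    using stone countable_subset unfolding omega_stone_space_def by blast
  ultimately show ?thesis using countable_image_inj_on by blast
qed

lemma countable_subset_Phat: "J \<subseteq> Phat \<Longrightarrow> countable J"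
  using countable_Phat countable_subset by blast

lemma clean_iff:
  assumes "w \<in> topspace W"
  shows "clean P lt W X w \<longleftrightarrow> lab w \<in> trim_ideal w"
  using label_in[OF assms] label_eq unfolding clean_def trim_ideal_def by blast

text \<open>The label of any point \<open>w\<close> is the supremum of the countable ideal \<open>trim_ideal w\<close>; if the label
  is separated, it must be a member of that ideal.\<close>

lemma separated_in_Phat:
  assumes "separated_elem P lt q" shows "q \<in> Phat"
proof -
  have "q \<in> P" using assms unfolding separated_elem_def by blast
  then obtain w where w: "w \<in> X q" using part_nonempty by blast
  then have "w \<in> topspace W" "lab w = q" using part_subset label_eq \<open>q \<in> P\<close> by auto
  then have "q \<in> trim_ideal w"
    using separated_sup_in_ideal[OF assms] trim_ideal_is_ideal trim_ideal_sup Phat_subset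
      countable_subset_Phat trim_ideal_subset by metis
  then show ?thesis using trim_ideal_subset by blast
qed

lemma shrinking_trim_base:
  assumes w: "w \<in> topspace W"
  obtains p and D :: "nat \<Rightarrow> 'w set" where "\<And>n. ptrim (p n) (D n)" "\<And>n. w \<in> D n"
    "\<And>U. openin W U \<Longrightarrow> w \<in> U \<Longrightarrow> \<exists>N. \<forall>n\<ge>N. D n \<subseteq> U"
proof -
  obtain E :: "nat \<Rightarrow> 'w set" where E: "\<And>n. compact_open W (E n)"
    and E_base: "\<And>U w. openin W U \<Longrightarrow> w \<in> U \<Longrightarrow> \<exists>n. w \<in> E n \<and> E n \<subseteq> U"
    using compact_open_base_enumeration[OF stone] by metis
  \<comment> \<open>The whole space is included to cover the case that no \<open>E i\<close> with \<open>i \<le> n\<close> contains \<open>w\<close>.\<close>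
  define C where "C n = topspace W \<inter> \<Inter> (E ` {i. i \<le> n \<and> w \<in> E i})" for n
  have "w \<in> C n" for n unfolding C_def using w by blast
  moreover have "openin W (C n)" for n
  proof (cases "{i. i \<le> n \<and> w \<in> E i} = {}")
    case True
    then show ?thesis unfolding C_def by (metis Inf_empty Int_UNIV_right image_empty openin_topspace)
  next
    case False
    then show ?thesis unfolding C_def
      using E by (intro openin_Int openin_topspace openin_Inter) (auto simp: compact_open_def)
  qed
  ultimately have "\<exists>p D. ptrim p D \<and> w \<in> D \<and> D \<subseteq> C n" for n
    by (metis trim_neighbourhood)
  then obtain p and D :: "nat \<Rightarrow> 'w set" where D: "\<And>n. ptrim (p n) (D n)" "\<And>n. w \<in> D n" "\<And>n. D n \<subseteq> C n" by metis
  have "\<exists>N. \<forall>n\<ge>N. D n \<subseteq> U" if U: "openin W U" "w \<in> U" for U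
  proof -
    obtain i where "w \<in> E i" "E i \<subseteq> U" using E_base[OF U] by blast
    then have "C n \<subseteq> U" if "n \<ge> i" for n using that unfolding C_def by blast
    then show ?thesis using D(3) by blast
  qed
  then show ?thesis using that D by blast
qed

text \<open>This is the approximation demanded by RP2: each trim neighbourhood of \<open>x\<close> contains a point
  whose label is the type of the neighbourhood, and this type differs from the label of \<open>x\<close>, which
  is not in \<open>Phat\<close>.\<close>

lemma lower_limit_if_label_notin_Phat:
  assumes x: "x \<in> topspace W" and "lab x \<notin> Phat"
  shows "\<exists>xs. range xs \<subseteq> topspace W \<and> limitin W xs x sequentially \<and>
    (\<forall>k. po_less lt (lab (xs k)) (lab x))"
proof -
  obtain p and D :: "nat \<Rightarrow> 'w set" where D: "\<And>n. ptrim (p n) (D n)" "\<And>n. x \<in> D n"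
    "\<And>U. openin W U \<Longrightarrow> x \<in> U \<Longrightarrow> \<exists>N. \<forall>n\<ge>N. D n \<subseteq> U"
    using shrinking_trim_base[OF x] by metis
  have p: "p n \<in> trim_ideal x" for n using D unfolding trim_ideal_def by blast
  then have pP: "p n \<in> P" "p n \<in> Phat" for n using trim_ideal_subset Phat_subset by blast+
  have "\<exists>y. y \<in> D n \<and> y \<in> X (p n)" for n
    using ptrim_meets_iff[OF D(1) pP(1), of n n] by auto
  then obtain xs where xs: "\<And>n. xs n \<in> D n" "\<And>n. xs n \<in> X (p n)" by metis
  have "lab (xs n) = p n" for n using xs(2) label_eq pP by blast
  then have "po_less lt (lab (xs n)) (lab x)" for n
    using trim_ideal_le_label[OF p] pP(2) assms(2) unfolding po_less_def by metis
  moreover have "range xs \<subseteq> topspace W" using xs(2) part_subset pP by blast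
  moreover have "limitin W xs x sequentially" using limitin_shrinking_sets[OF x D(3) xs(1)] .
  ultimately show ?thesis by blast
qed

section \<open>Compact trim labels and rank partitions\<close>

lemma trim_ideal_if_compact:
  assumes q: "compact_elem P lt q" "q \<in> Phat" and x: "x \<in> topspace W" and "q \<preceq> lab x"
  shows "q \<in> trim_ideal x"
proof -
  have I: "po_ideal Phat lt (trim_ideal x)" using trim_ideal_is_ideal x .
  have "\<exists>d\<in>trim_ideal x. q \<preceq> d"
    using compact_below_directed_sup[OF q(1) _ _ _ trim_ideal_sup[OF x] \<open>q \<preceq> lab x\<close>] I Phat_subset
    unfolding po_ideal_def by blast
  then show ?thesis using I q(2) unfolding po_ideal_def by blast
qed

lemma rank_if_compact:
  assumes c: "\<forall>p\<in>Phat. compact_elem P lt p"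
  shows "rank_partition P lt W X"
proof -
  have "RP2 P lt W X"
    using c compact_imp_separated lower_limit_if_label_notin_Phat unfolding RP2_def by blast
  moreover have "RP1 P lt W X"
    unfolding RP1_def
  proof (intro allI impI, elim conjE)
    fix q x xs
    assume q: "separated_elem P lt q" and x: "x \<in> topspace W" and "q \<preceq> lab x"
      and lim: "limitin W xs x sequentially"
    have "q \<in> trim_ideal x"
      using separated_in_Phat[OF q] c trim_ideal_if_compact x \<open>q \<preceq> lab x\<close> by blast
    then obtain A where A: "ptrim q A" "x \<in> A" unfolding trim_ideal_def by blast
    then have "\<forall>\<^sub>F k in sequentially. xs k \<in> A" using lim ptrim_open unfolding limitin_def by blast
    then show "\<forall>\<^sub>F k in sequentially. q \<preceq> lab (xs k)"
      by (rule eventually_mono) (use A trim_ideal_le_label in \<open>auto simp: trim_ideal_def\<close>)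
  qed
  ultimately show ?thesis using complete unfolding rank_partition_def by blast
qed

text \<open>A \<open>q\<close>-trim set \<open>A\<close> contains a point of \<open>X q\<close> and no point with a label strictly
  below \<open>q\<close>, so the sequence that RP2 would provide for a non-separated \<open>q\<close> cannot converge
  to that point.\<close>

lemma rank_imp_separated:
  assumes RP2: "RP2 P lt W X" and q: "q \<in> Phat"
  shows "separated_elem P lt q"
proof (rule ccontr)
  assume nsep: "\<not> separated_elem P lt q"
  obtain A where A: "ptrim q A" and qP: "q \<in> P" using q unfolding trim_labels_def by blast
  then obtain x where x: "x \<in> A" "x \<in> X q" using ptrim_meets_iff[OF A qP] by auto
  then have xW: "x \<in> topspace W" and "lab x = q" using part_subset qP label_eq by auto
  then obtain xs where xs: "limitin W xs x sequentially" "\<And>k. po_less lt (lab (xs k)) q"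
    and xsW: "range xs \<subseteq> topspace W"
    using RP2 nsep unfolding RP2_def by metis
  have "\<forall>\<^sub>F k in sequentially. xs k \<in> A" using xs(1) x(1) ptrim_open[OF A] unfolding limitin_def by blast
  then obtain k where "xs k \<in> A" using eventually_happens by fastforce
  then have "q \<preceq> lab (xs k)" using trim_ideal_le_label A unfolding trim_ideal_def by blast
  moreover have "lab (xs k) \<in> P" using label_in xsW by blast
  ultimately show False using xs(2)[of k] le_antisym qP unfolding po_less_def by blast
qed

text \<open>If \<open>trim_ideal x\<close> omits \<open>q\<close>, it has no greatest element, for that would be the label
  of \<open>x\<close>. So it contains a strictly increasing sequence dominating the types of shrinking
  neighbourhoods of \<open>x\<close>, and points with these labels converge to \<open>x\<close>. By RP1 their labels are
  eventually above \<open>q\<close>, which puts \<open>q\<close> into the ideal after all.\<close>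

lemma rank_imp_trim_ideal:
  assumes rank: "rank_partition P lt W X" and q: "q \<in> Phat" and x: "x \<in> topspace W" and "q \<preceq> lab x"
  shows "q \<in> trim_ideal x"
proof (rule ccontr)
  assume nq: "q \<notin> trim_ideal x"
  have RP1: "RP1 P lt W X" and RP2: "RP2 P lt W X" using rank unfolding rank_partition_def by auto
  have qsep: "separated_elem P lt q" using rank_imp_separated RP2 q .
  have I: "po_ideal Phat lt (trim_ideal x)" using trim_ideal_is_ideal x .
  have ng: "\<not> (\<exists>m\<in>trim_ideal x. \<forall>y\<in>trim_ideal x. y \<preceq> m)"
  proof
    assume "\<exists>m\<in>trim_ideal x. \<forall>y\<in>trim_ideal x. y \<preceq> m"
    then obtain m where m: "m \<in> trim_ideal x" "\<forall>y\<in>trim_ideal x. y \<preceq> m" by blast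
    then have "m \<in> P" using trim_ideal_subset Phat_subset by blast
    then have "lab x = m" using m sup_unique[OF trim_ideal_sup[OF x]] unfolding is_sup_def by blast
    then show False using nq m(1) I q \<open>q \<preceq> lab x\<close> unfolding po_ideal_def by blast
  qed
  obtain p and D :: "nat \<Rightarrow> 'w set" where D: "\<And>n. ptrim (p n) (D n)" "\<And>n. x \<in> D n"
    "\<And>U. openin W U \<Longrightarrow> x \<in> U \<Longrightarrow> \<exists>N. \<forall>n\<ge>N. D n \<subseteq> U"
    using shrinking_trim_base[OF x] by metis
  have "range p \<subseteq> trim_ideal x" using D unfolding trim_ideal_def by blast
  then obtain s where s: "range s \<subseteq> trim_ideal x" "strictly_increasing lt s" "\<And>n. p n \<preceq> s n"
    using ideal_dominating_sequence[OF I Phat_subset ng] by blast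
  have sP: "s n \<in> P" for n using s(1) trim_ideal_subset Phat_subset by blast
  have "\<exists>y. y \<in> D n \<and> y \<in> X (s n)" for n
    using ptrim_meets_iff[OF D(1) sP, of n n] s(3) by auto
  then obtain xs where xs: "\<And>n. xs n \<in> D n" "\<And>n. xs n \<in> X (s n)" by metis
  have lab: "lab (xs n) = s n" for n using xs(2) label_eq sP by blast
  have "range xs \<subseteq> topspace W" using xs(2) part_subset sP by blast
  moreover have "limitin W xs x sequentially" using limitin_shrinking_sets[OF x D(3) xs(1)] .
  ultimately have "\<forall>\<^sub>F k in sequentially. q \<preceq> lab (xs k)"
    using RP1[unfolded RP1_def, rule_format, of q x xs] qsep x \<open>q \<preceq> lab x\<close> s(2) by (simp add: lab)
  then obtain k where "q \<preceq> s k" using lab eventually_happens by fastforce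
  then show False using nq I q s(1) unfolding po_ideal_def by blast
qed

end

section \<open>Realising ideals by points\<close>

locale ST3_partition = T1_partition P lt W X
  for P :: "'p set" and lt :: "'p \<Rightarrow> 'p \<Rightarrow> bool" and W :: "'w topology" and X :: "'p \<Rightarrow> 'w set" +
  assumes ST3: "ST3 P lt W X"
begin

text \<open>The open set contains a clean point \<open>v\<close> of \<open>X p\<close>. A trim neighbourhood of \<open>v\<close> inside a
  \<open>p\<close>-trim one has type at least \<open>p\<close> because of the inclusion, and at most \<open>p\<close> because it
  contains \<open>v\<close>.\<close>

lemma ptrim_inside_open:
  assumes U: "openin W U" "U \<inter> X p \<noteq> {}" and p: "p \<in> Phat"
  obtains B where "ptrim p B" "B \<subseteq> U"
proof -
  have pP: "p \<in> P" using p Phat_subset by blast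
  obtain u where "u \<in> U" "u \<in> X p" using U by blast
  then have "u \<in> W closure_of {w \<in> X p. clean P lt W X w}" using ST3 p unfolding ST3_def by blast
  then obtain v where v: "v \<in> X p" "clean P lt W X v" "v \<in> U"
    using U \<open>u \<in> U\<close> unfolding in_closure_of by blast
  then have vW: "v \<in> topspace W" and lab: "lab v = p" using part_subset pP label_eq by auto
  then obtain A where A: "ptrim p A" "v \<in> A" using clean_iff v(2) unfolding trim_ideal_def by auto
  have "openin W (A \<inter> U)" "v \<in> A \<inter> U" using A U v ptrim_open by auto
  then obtain r B where B: "ptrim r B" "v \<in> B" "B \<subseteq> A \<inter> U" by (rule trim_neighbourhood)
  have "p \<preceq> r" using ptrim_subset_le B A by blast
  moreover have "r \<preceq> p" using trim_ideal_le_label[of r v] B lab unfolding trim_ideal_def by blast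
  moreover have "r \<in> P" using B(1) unfolding p_trim_def by blast
  ultimately have "r = p" using le_antisym pP by blast
  then show ?thesis using that B by blast
qed

text \<open>Along a cofinal chain \<open>s\<close> in \<open>J\<close>, choose nested sets \<open>A n\<close> that are \<open>s n\<close>-trim,
  letting \<open>A (Suc n)\<close> lie on one side of the \<open>n\<close>-th compact open set \<open>E n\<close>. By compactness the
  \<open>A n\<close> have a common point \<open>w\<close>, and deciding every \<open>E n\<close> makes them a neighbourhood base at
  \<open>w\<close>, so the types of trim neighbourhoods of \<open>w\<close> are exactly the elements of \<open>Phat\<close> below
  some \<open>s n\<close>.\<close>

lemma trim_ideal_realises_ideal:
  assumes J: "po_ideal Phat lt J"
  obtains w where "w \<in> topspace W" "trim_ideal w = J"
proof -
  have JPhat: "J \<subseteq> Phat" using J unfolding po_ideal_def by blast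
  obtain s where s: "range s \<subseteq> J" "\<And>n. s n \<preceq> s (Suc n)" "\<And>x. x \<in> J \<Longrightarrow> \<exists>n. x \<preceq> s n"
    using ideal_cofinal_chain[OF J Phat_subset countable_subset_Phat[OF JPhat]] by blast
  have sPhat: "s n \<in> Phat" and sP: "s n \<in> P" for n using s(1) JPhat Phat_subset by blast+
  obtain E :: "nat \<Rightarrow> 'w set" where E: "\<And>n. compact_open W (E n)"
    and E_base: "\<And>U w. openin W U \<Longrightarrow> w \<in> U \<Longrightarrow> \<exists>n. w \<in> E n \<and> E n \<subseteq> U"
    using compact_open_base_enumeration[OF stone] by metis
  have haus: "Hausdorff_space W" using stone unfolding omega_stone_space_def by blast
  have closedE: "closedin W (E n)" for n
    using E haus compactin_imp_closedin unfolding compact_open_def by blast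
  have "\<exists>A. \<forall>n. ptrim (s n) (A n) \<and>
      (A (Suc n) \<subseteq> A n \<and> (A (Suc n) \<subseteq> E n \<or> A (Suc n) \<inter> E n = {}))"
  proof (rule dependent_nat_choice)
    show "\<exists>A. ptrim (s 0) A" using sPhat unfolding trim_labels_def by blast
    fix A n assume A: "ptrim (s n) A"
    then have pieces: "openin W (A \<inter> E n)" "openin W (A - E n)"
      using E closedE ptrim_open unfolding compact_open_def by (auto intro: openin_diff)
    have "A \<inter> X (s (Suc n)) \<noteq> {}" using ptrim_meets_iff[OF A sP] s(2) by blast
    then consider "(A \<inter> E n) \<inter> X (s (Suc n)) \<noteq> {}" | "(A - E n) \<inter> X (s (Suc n)) \<noteq> {}" by blast
    then show "\<exists>B. ptrim (s (Suc n)) B \<and> (B \<subseteq> A \<and> (B \<subseteq> E n \<or> B \<inter> E n = {}))"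
    proof cases
      case 1
      then obtain B where "ptrim (s (Suc n)) B" "B \<subseteq> A \<inter> E n"
        using ptrim_inside_open pieces(1) sPhat by blast
      then show ?thesis by blast
    next
      case 2
      then obtain B where "ptrim (s (Suc n)) B" "B \<subseteq> A - E n"
        using ptrim_inside_open pieces(2) sPhat by blast
      then show ?thesis by blast
    qed
  qed
  then obtain A where A: "\<And>n. ptrim (s n) (A n)" "\<And>n. A (Suc n) \<subseteq> A n"
    "\<And>n. A (Suc n) \<subseteq> E n \<or> A (Suc n) \<inter> E n = {}" by blast
  have dec: "decseq A" using A(2) by (rule decseq_SucI)
  have ne: "A n \<noteq> {}" for n using ptrim_meets_iff[OF A(1) sP, of n n] by auto
  have compA: "compactin W (A n)" for n using A(1) unfolding p_trim_def compact_open_def by blast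
  have "\<Inter> (range A) \<noteq> {}"
  proof -
    have "closedin (subtopology W (A 0)) (A n)" for n
    proof (rule closedin_subset_topspace)
      show "closedin W (A n)" using haus compA compactin_imp_closedin by blast
      show "A n \<subseteq> A 0" using dec unfolding decseq_def by blast
    qed
    moreover have "compact_space (subtopology W (A 0))"
      using compA compact_space_subtopology by blast
    ultimately show ?thesis using compact_space_imp_nest[of "subtopology W (A 0)" A] dec ne by simp
  qed
  then obtain w where w: "\<And>n. w \<in> A n" by blast
  have wW: "w \<in> topspace W" using w ptrim_open[OF A(1)] openin_subset by blast
  have base: "\<exists>n. A n \<subseteq> U" if "openin W U" "w \<in> U" for U
    using E_base[OF that] A(3) w by blast
  have "trim_ideal w = J"
  proof
    show "trim_ideal w \<subseteq> J"
    proof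
      fix p assume p: "p \<in> trim_ideal w"
      then obtain B where B: "ptrim p B" "w \<in> B" unfolding trim_ideal_def by blast
      then obtain n where "A n \<subseteq> B" using base ptrim_open by blast
      then have "p \<preceq> s n" using ptrim_subset_le[OF A(1) B(1)] by blast
      then show "p \<in> J" using J s(1) p trim_ideal_subset unfolding po_ideal_def by blast
    qed
    show "J \<subseteq> trim_ideal w"
    proof
      fix p assume p: "p \<in> J"
      then obtain n where "p \<preceq> s n" using s(3) by blast
      moreover have "s n \<in> trim_ideal w" using A(1) w unfolding trim_ideal_def by blast
      ultimately show "p \<in> trim_ideal w"
        using trim_ideal_is_ideal[OF wW] p JPhat unfolding po_ideal_def by blast
    qed
  qed
  then show ?thesis using that wW by blast
qed

section \<open>The two equivalences\<close>

lemma SST3_iff_weakly_separated: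
  "SST3 P lt W X \<longleftrightarrow> weakly_separated Phat P lt"
proof
  assume SST3: "SST3 P lt W X"
  show "weakly_separated Phat P lt"
    unfolding weakly_separated_def
  proof (intro conjI ballI allI impI, rule Phat_subset, elim conjE)
    fix p J assume p: "p \<in> Phat" and J: "po_ideal Phat lt J" and sup: "is_sup P lt J p"
    obtain w where w: "w \<in> topspace W" "trim_ideal w = J" using trim_ideal_realises_ideal J .
    then have "lab w = p" using trim_ideal_sup sup sup_unique by blast
    then show "p \<in> J" using SST3 p w clean_iff label_in unfolding SST3_def by metis
  qed
next
  assume ws: "weakly_separated Phat P lt"
  show "SST3 P lt W X"
    unfolding SST3_def
  proof (intro ballI)
    fix p w assume "p \<in> Phat" "w \<in> X p"
    then have "w \<in> topspace W" "lab w = p" using part_subset label_eq Phat_subset by blast+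
    then show "clean P lt W X w"
      using ws \<open>p \<in> Phat\<close> trim_ideal_is_ideal trim_ideal_sup clean_iff
      unfolding weakly_separated_def by metis
  qed
qed

text \<open>Ideals of \<open>P\<close> need not be countable, but only the trace on \<open>Phat\<close> matters. It has the same
  supremum because every label is the supremum of some trim ideal. It is directed because, for
  a rank partition, two elements of \<open>Phat\<close> below a common label are both in the trim
  ideal of one point with that label.\<close>

lemma compact_if_rank:
  assumes rank: "rank_partition P lt W X" and q: "q \<in> Phat"
  shows "compact_elem P lt q"
  unfolding compact_elem_def
proof (intro conjI allI impI, use q Phat_subset in blast, elim conjE)
  fix J s assume J: "po_ideal P lt J" and sup: "is_sup P lt J s" and "q \<preceq> s"
  have below: "\<exists>w. w \<in> topspace W \<and> lab w = j \<and> trim_ideal w \<subseteq> J" if "j \<in> J" for j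
  proof -
    have jP: "j \<in> P" using \<open>j \<in> J\<close> J unfolding po_ideal_def by blast
    then obtain w where w: "w \<in> X j" using part_nonempty by blast
    have "p \<in> J" if p: "p \<in> trim_ideal w" for p
    proof -
      have "p \<preceq> j" using trim_ideal_le_label[OF p] label_eq[OF jP w] by simp
      then show ?thesis
        using J \<open>j \<in> J\<close> p trim_ideal_subset Phat_subset unfolding po_ideal_def by blast
    qed
    then show ?thesis using w jP part_subset label_eq by blast
  qed
  have "po_ideal Phat lt (J \<inter> Phat)"
    unfolding po_ideal_def
  proof (intro conjI ballI impI)
    show "J \<inter> Phat \<noteq> {}"
    proof -
      obtain j where "j \<in> J" using J unfolding po_ideal_def by blast
      then obtain w where w: "w \<in> topspace W" "trim_ideal w \<subseteq> J" using below by blast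
      then show ?thesis
        using trim_ideal_is_ideal[OF w(1)] unfolding po_ideal_def by blast
    qed
    show "y \<in> J \<inter> Phat" if "x \<in> J \<inter> Phat" "y \<in> Phat" "y \<preceq> x" for x y
      using that J Phat_subset unfolding po_ideal_def by blast
    show "\<exists>z\<in>J \<inter> Phat. x \<preceq> z \<and> y \<preceq> z" if xy: "x \<in> J \<inter> Phat" "y \<in> J \<inter> Phat" for x y
    proof -
      obtain j where j: "j \<in> J" "x \<preceq> j" "y \<preceq> j" using xy J unfolding po_ideal_def by blast
      then obtain w where w: "w \<in> topspace W" "lab w = j" "trim_ideal w \<subseteq> J" using below by blast
      have "x \<in> trim_ideal w" "y \<in> trim_ideal w"
        using rank_imp_trim_ideal[OF rank] xy w j by auto
      then obtain z where "z \<in> trim_ideal w" "x \<preceq> z" "y \<preceq> z"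
        using trim_ideal_is_ideal[OF w(1)] unfolding po_ideal_def by blast
      then show ?thesis using w(3) trim_ideal_subset by blast
    qed
  qed simp
  then obtain w where w: "w \<in> topspace W" "trim_ideal w = J \<inter> Phat"
    by (rule trim_ideal_realises_ideal)
  have "is_sup P lt (J \<inter> Phat) s"
    unfolding is_sup_def
  proof (intro conjI ballI impI)
    show "s \<in> P" "\<And>x. x \<in> J \<inter> Phat \<Longrightarrow> x \<preceq> s" using sup unfolding is_sup_def by blast+
    fix u assume u: "u \<in> P" "\<forall>x\<in>J \<inter> Phat. x \<preceq> u"
    have "j \<preceq> u" if "j \<in> J" for j
    proof -
      obtain v where v: "v \<in> topspace W" "lab v = j" "trim_ideal v \<subseteq> J" using below[OF \<open>j \<in> J\<close>] by blast
      then have "\<forall>x\<in>trim_ideal v. x \<preceq> u" using u(2) trim_ideal_subset by blast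
      then show ?thesis using trim_ideal_sup[OF v(1)] u(1) v(2) unfolding is_sup_def by blast
    qed
    then show "s \<preceq> u" using sup u(1) unfolding is_sup_def by blast
  qed
  then have "lab w = s" using trim_ideal_sup[OF w(1)] w(2) sup_unique by metis
  then have "q \<in> trim_ideal w" using rank_imp_trim_ideal[OF rank q w(1)] \<open>q \<preceq> s\<close> by simp
  then show "q \<in> J" using w(2) by blast
qed

end

theorem proposition4p14:
  fixes P :: "'p set" and lt :: "'p \<Rightarrow> 'p \<Rightarrow> bool"
    and W :: "'w topology" and X :: "'p \<Rightarrow> 'w set"
  assumes "po_system P lt"
    and "omega_stone_space W"
    and "semi_trim_partition P lt W X"
  shows "(strongly_semi_trim_partition P lt W X \<longleftrightarrow>
            weakly_separated (trim_labels P lt W X) P lt) \<and>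
         (rank_partition P lt W X \<longleftrightarrow>
            (\<forall>p\<in>trim_labels P lt W X. compact_elem P lt p))"
proof -
  interpret ST3_partition P lt W X
    using assms by unfold_locales (auto simp: semi_trim_partition_def)
  have "strongly_semi_trim_partition P lt W X \<longleftrightarrow> SST3 P lt W X"
    using assms(3) unfolding semi_trim_partition_def strongly_semi_trim_partition_def by blast
  then show ?thesis
    using SST3_iff_weakly_separated rank_if_compact compact_if_rank by blast
qed

end
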